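(* Assume $n \alpha_n \to \alpha \in (0, \infty)$ as $n\to\infty$. Then, for all $x>0$, $$P [M_n \leq x] \to F_\alpha(x) := \exp \left( -\alpha \int_x^\infty \frac{e^{-u}}u\, du \right)\quad\text{as } n\to\infty.$$
   Context: Let $(\alpha_n)_{n\ge 1}$ be a sequence of positive real numbers. For each $n$, let $Y_{1n},\ldots,Y_{nn}$ be i.i.d. random variables with the Gamma$(\alpha_n,1)$ distribution, i.e. with density $u^{\alpha_n-1}e^{-u}/\Gamma(\alpha_n)$ on $(0,\infty)$, and let $M_n=\max\{Y_{1n},\ldots,Y_{nn}\}$. *)

theory Defs
  imports "HOL-Probability.Probability"
begin

text \<open>Density of Gamma(a, 1): shape a, rate 1, with respect to Lebesgue measure.\<close>

definition gamma_density :: "real \<Rightarrow> real \<Rightarrow> real" where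
  "gamma_density a u = (if 0 < u then u powr (a - 1) * exp (- u) / Gamma a else 0)"

text \<open>Only meaningful for \<open>n \<ge> 1\<close>: for \<open>n = 0\<close> this is the unspecified \<open>Max {}\<close>.\<close>

definition row_max :: "(nat \<Rightarrow> nat \<Rightarrow> 'a \<Rightarrow> real) \<Rightarrow> nat \<Rightarrow> 'a \<Rightarrow> real" where
  "row_max Y n \<omega> = Max ((\<lambda>i. Y n i \<omega>) ` {1..n})"

definition F_lim :: "real \<Rightarrow> real \<Rightarrow> real" where
  "F_lim a x = exp (- a * (LBINT u:{x<..}. exp (- u) / u))"

end

(* Since Gamma (1 + b) = b * Gamma b, the tail p_n = P(Y > x) of the Gamma(\<alpha>_n, 1) law equals
   \<alpha>_n / Gamma(1 + \<alpha>_n) times the integral of u powr (\<alpha>_n - 1) * exp (-u) over u > x. As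
   \<alpha>_n tends to 0, dominated convergence gives that n * p_n tends to \<alpha> times the integral of
   exp (-u) / u over u > x. By independence P(M_n \<le> x) = (1 - p_n)^n, which therefore has the
   limit F_\<alpha>(x). *)

theory Submission
  imports Defs
begin

text \<open>Pointwise, u powr (b n - 1) tends to 1 / u for u > x; since x > 0 keeps u away from the
  singularity at 0, a constant multiple of exp (-u) dominates.\<close>

lemma powr_tail_integral_tendsto:
  fixes b :: "nat \<Rightarrow> real"
  assumes b: "b \<longlonglongrightarrow> 0" and x: "x > 0"
  shows "(\<lambda>n. LBINT u:{x<..}. u powr (b n - 1) * exp (- u))
           \<longlonglongrightarrow> (LBINT u:{x<..}. exp (- u) / u)"
proof -
  \<comment> \<open>Dominated convergence asks for a bound valid at every n, while
    \<open>b n\<close> is only eventually near 0. Clamping to [-1, 1] puts the exponent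
    \<open>c n - 1\<close> in [-2, 0] for all n, and \<open>c n = b n\<close> eventually.\<close>
  define c where "c n = max (-1) (min 1 (b n))" for n
  have "c \<longlonglongrightarrow> max (-1) (min 1 0)"
    unfolding c_def by (intro tendsto_intros b)
  then have c0: "c \<longlonglongrightarrow> 0" by simp
  have c_le: "c n \<le> 1" "-1 \<le> c n" for n by (auto simp: c_def)
  have bound: "u powr (c n - 1) \<le> 1 + 1 / x ^ 2" if "u > x" for u n
  proof -
    \<comment> \<open>The exponent is at most 0, so the power decreases in u. At the endpoint x, the
      summand 1 covers x \<ge> 1 and 1 / x ^ 2 covers x < 1, where the extreme exponent is
      -2.\<close>
    have "u powr (c n - 1) \<le> x powr (c n - 1)"
      using that x c_le[of n] by (intro powr_mono2') auto
    also have "\<dots> \<le> 1 + 1 / x ^ 2"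
    proof (cases "x \<ge> 1")
      case True
      then have "x powr (c n - 1) \<le> x powr 0"
        using c_le[of n] by (intro powr_mono) auto
      then have "x powr (c n - 1) \<le> 1" using True by simp
      moreover have "0 \<le> 1 / x ^ 2" by simp
      ultimately show ?thesis by linarith
    next
      case False
      then have "x powr (c n - 1) \<le> x powr (- 2)"
        using c_le[of n] x by (intro powr_mono') auto
      also have "\<dots> = 1 / x ^ 2" using x by (simp add: powr_minus_divide)
      finally show ?thesis by simp
    qed
    finally show ?thesis .
  qed
  have "set_integrable lborel {0<..} (\<lambda>u::real. exp (- u))"
    using integrable_I0i_exp_mscale[of 1] by simp
  then have "set_integrable lborel {x<..} (\<lambda>u. exp (- u))"
    by (rule set_integrable_subset) (use x in auto)
  then have w: "set_integrable lborel {x<..} (\<lambda>u. (1 + 1 / x ^ 2) * exp (- u))"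
    by simp
  have "(\<lambda>n. LBINT u:{x<..}. u powr (c n - 1) * exp (- u))
          \<longlonglongrightarrow> (LBINT u:{x<..}. exp (- u) / u)"
    unfolding set_lebesgue_integral_def
  proof (rule integral_dominated_convergence[OF _ _ w[unfolded set_integrable_def]])
    show "AE u in lborel. (\<lambda>n. indicator {x<..} u *\<^sub>R (u powr (c n - 1) * exp (- u)))
            \<longlonglongrightarrow> indicator {x<..} u *\<^sub>R (exp (- u) / u)"
    proof (rule AE_I2)
      fix u :: real
      show "(\<lambda>n. indicator {x<..} u *\<^sub>R (u powr (c n - 1) * exp (- u)))
              \<longlonglongrightarrow> indicator {x<..} u *\<^sub>R (exp (- u) / u)"
      proof (cases "u > x")
        case True
        have "(\<lambda>n. u powr (c n - 1) * exp (- u)) \<longlonglongrightarrow> u powr (0 - 1) * exp (- u)"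
          using True x by (intro tendsto_intros c0) auto
        then show ?thesis using True x by (simp add: powr_minus_divide)
      qed simp
    qed
    show "AE u in lborel. norm (indicator {x<..} u *\<^sub>R (u powr (c n - 1) * exp (- u)))
            \<le> indicator {x<..} u *\<^sub>R ((1 + 1 / x ^ 2) * exp (- u))" for n
      using bound[of _ n] by (intro AE_I2) (auto simp: abs_mult intro!: mult_right_mono split: split_indicator)
  qed measurable
  moreover have "\<forall>\<^sub>F n in sequentially. c n = b n"
    using order_tendstoD(2)[OF b zero_less_one] order_tendstoD(1)[OF b, of "-1", simplified]
    by eventually_elim (auto simp: c_def)
  then have "\<forall>\<^sub>F n in sequentially. (LBINT u:{x<..}. u powr (c n - 1) * exp (- u))
               = (LBINT u:{x<..}. u powr (b n - 1) * exp (- u))"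
    by eventually_elim simp
  ultimately show ?thesis by (rule Lim_transform_eventually)
qed

lemma tendsto_zero_of_tendsto_real_mult:
  fixes f :: "nat \<Rightarrow> real"
  assumes "(\<lambda>n. real n * f n) \<longlonglongrightarrow> c"
  shows "f \<longlonglongrightarrow> 0"
proof -
  have "(\<lambda>n. real n * f n * inverse (real n)) \<longlonglongrightarrow> c * 0"
    by (intro tendsto_mult assms tendsto_inverse_0_at_top filterlim_real_sequentially)
  moreover have "\<forall>\<^sub>F n in sequentially. real n * f n * inverse (real n) = f n"
    using eventually_gt_at_top[of 0] by eventually_elim simp
  ultimately show ?thesis by (simp add: Lim_transform_eventually)
qed

text \<open>Squeeze: both bounds come from 1 + t \<le> exp t, with t = -p for the upper one and t =
  p / (1 - p) for the lower one, where 1 + t = 1 / (1 - p). Both exponents tend to -c because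
  \<open>p\<close> tends to 0.\<close>

lemma one_minus_power_tendsto_exp:
  fixes p :: "nat \<Rightarrow> real"
  assumes p0: "\<And>n. p n \<ge> 0" and np: "(\<lambda>n. real n * p n) \<longlonglongrightarrow> c"
  shows "(\<lambda>n. (1 - p n) ^ n) \<longlonglongrightarrow> exp (- c)"
proof (rule tendsto_sandwich)
  have p: "p \<longlonglongrightarrow> 0" by (rule tendsto_zero_of_tendsto_real_mult[OF np])
  then have lt: "\<forall>\<^sub>F n in sequentially. p n < 1" by (rule order_tendstoD) simp
  show "\<forall>\<^sub>F n in sequentially. (1 - p n) ^ n \<le> exp (- (real n * p n))"
    using lt
  proof eventually_elim
    case (elim n)
    have "(1 - p n) ^ n \<le> exp (- p n) ^ n"
      using exp_ge_add_one_self[of "- p n"] elim by (intro power_mono) auto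
    then show ?case by (simp add: exp_of_nat_mult[symmetric])
  qed
  show "\<forall>\<^sub>F n in sequentially. exp (- (real n * p n / (1 - p n))) \<le> (1 - p n) ^ n"
    using lt
  proof eventually_elim
    case (elim n)
    have "1 / (1 - p n) \<le> exp (p n / (1 - p n))"
      using exp_ge_add_one_self[of "p n / (1 - p n)"] elim by (simp add: field_simps)
    then have "exp (- (p n / (1 - p n))) \<le> 1 - p n"
      using elim by (simp add: exp_minus field_simps)
    then have "exp (- (p n / (1 - p n))) ^ n \<le> (1 - p n) ^ n"
      by (intro power_mono) auto
    then show ?case by (simp add: exp_of_nat_mult[symmetric])
  qed
  show "(\<lambda>n. exp (- (real n * p n))) \<longlonglongrightarrow> exp (- c)"
    by (intro tendsto_intros np)
  have "(\<lambda>n. exp (- (real n * p n / (1 - p n)))) \<longlonglongrightarrow> exp (- (c / (1 - 0)))"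
    by (intro tendsto_intros np p) simp
  then show "(\<lambda>n. exp (- (real n * p n / (1 - p n)))) \<longlonglongrightarrow> exp (- c)" by simp
qed

text \<open>Writing 1 / Gamma b as b / Gamma (b + 1) isolates the factor b, which n will compensate,
  and leaves a coefficient continuous at b = 0, where Gamma b itself has a pole.\<close>

lemma (in prob_space) gamma_tail_prob:
  assumes D: "distributed M lborel X (gamma_density b)" and b: "b > 0" and x: "x > 0"
  shows "prob (X -` {x<..} \<inter> space M)
           = b / Gamma (b + 1) * (LBINT u:{x<..}. u powr (b - 1) * exp (- u))"
proof -
  have "emeasure M (X -` {x<..} \<inter> space M)
      = (\<integral>\<^sup>+u. ennreal (gamma_density b u) * indicator {x<..} u \<partial>lborel)"
    by (rule distributed_emeasure[OF D]) simp
  also have "\<dots> = (\<integral>\<^sup>+u. ennreal (indicator {x<..} u *\<^sub>R (u powr (b - 1) * exp (- u)) / Gamma b) \<partial>lborel)"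
    using x by (intro nn_integral_cong) (auto simp: gamma_density_def split: split_indicator)
  finally have "prob (X -` {x<..} \<inter> space M)
      = (\<integral>u. indicator {x<..} u *\<^sub>R (u powr (b - 1) * exp (- u)) / Gamma b \<partial>lborel)"
    using Gamma_real_pos[OF b] by (subst integral_eq_nn_integral) (auto simp: measure_def)
  also have "\<dots> = (LBINT u:{x<..}. u powr (b - 1) * exp (- u)) / Gamma b"
    unfolding set_lebesgue_integral_def by (rule integral_divide_zero)
  also have "Gamma (b + 1) = b * Gamma b"
    using b by (intro Gamma_plus1) (auto elim!: nonpos_Ints_cases)
  then have "(LBINT u:{x<..}. u powr (b - 1) * exp (- u)) / Gamma b
      = b / Gamma (b + 1) * (LBINT u:{x<..}. u powr (b - 1) * exp (- u))"
    using b by simp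
  finally show ?thesis .
qed

text \<open>The maximum is at most x exactly when every entry is, so the event is a finite
  intersection and independence turns its probability into a product. The condition n \<ge> 1 makes
  the index set nonempty, as both \<open>Max\<close> and the product rule require.\<close>

lemma (in prob_space) row_max_cdf:
  assumes n: "n \<ge> 1" and indep: "indep_vars (\<lambda>_. borel) (Y n) {1..n}"
    and tail: "\<And>i. i \<in> {1..n} \<Longrightarrow> prob (Y n i -` {x<..} \<inter> space M) = p"
  shows "prob {\<omega> \<in> space M. row_max Y n \<omega> \<le> x} = (1 - p) ^ n"
proof -
  have "{\<omega> \<in> space M. row_max Y n \<omega> \<le> x} = (\<Inter>i\<in>{1..n}. Y n i -` {..x} \<inter> space M)"
    using n by (auto simp: row_max_def)
  also have "prob \<dots> = (\<Prod>i\<in>{1..n}. prob (Y n i -` {..x} \<inter> space M))"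
    using n by (intro indep_varsD_finite[OF indep]) auto
  also have "\<dots> = (\<Prod>i\<in>{1..n}. 1 - p)"
  proof (rule prod.cong)
    fix i assume i: "i \<in> {1..n}"
    have "random_variable borel (Y n i)"
      using indep i by (auto simp: indep_vars_def)
    then have "Y n i -` {x<..} \<inter> space M \<in> events" by measurable
    moreover have "Y n i -` {..x} \<inter> space M = space M - (Y n i -` {x<..} \<inter> space M)" by auto
    ultimately show "prob (Y n i -` {..x} \<inter> space M) = 1 - p"
      using tail[OF i] by (simp add: prob_compl)
  qed simp
  finally show ?thesis by simp
qed

theorem theorem2p6:
  fixes P :: "nat \<Rightarrow> 'a measure"
    and Y :: "nat \<Rightarrow> nat \<Rightarrow> 'a \<Rightarrow> real"
    and \<alpha> :: "nat \<Rightarrow> real"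
    and a :: real
  assumes alpha_pos: "\<And>n. n \<ge> 1 \<Longrightarrow> \<alpha> n > 0"
    and prob: "\<And>n. n \<ge> 1 \<Longrightarrow> prob_space (P n)"
    and indep: "\<And>n. n \<ge> 1 \<Longrightarrow> prob_space.indep_vars (P n) (\<lambda>_. borel) (Y n) {1..n}"
    and gamma: "\<And>n i. n \<ge> 1 \<Longrightarrow> i \<in> {1..n} \<Longrightarrow>
                  distributed (P n) lborel (Y n i) (gamma_density (\<alpha> n))"
    and a_pos: "a > 0"
    and lim: "(\<lambda>n. real n * \<alpha> n) \<longlonglongrightarrow> a"
  shows "\<forall>x>0. (\<lambda>n. measure (P n) {\<omega> \<in> space (P n). row_max Y n \<omega> \<le> x}) \<longlonglongrightarrow> F_lim a x"
proof (intro allI impI)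
  fix x :: real assume x: "x > 0"
  define J where "J n = (LBINT u:{x<..}. u powr (\<alpha> n - 1) * exp (- u))" for n
  \<comment> \<open>Nothing is assumed about \<alpha> at index 0; the value 0 there makes
    \<open>p\<close> nonnegative at every index, as the exponential limit lemma demands.\<close>
  define p where "p n = (if n = 0 then 0 else \<alpha> n / Gamma (\<alpha> n + 1) * J n)" for n
  have \<alpha>0: "\<alpha> \<longlonglongrightarrow> 0" by (rule tendsto_zero_of_tendsto_real_mult[OF lim])
  have tail: "measure (P n) (Y n i -` {x<..} \<inter> space (P n)) = p n"
    if "n \<ge> 1" "i \<in> {1..n}" for n i
    using prob_space.gamma_tail_prob[OF prob gamma alpha_pos x] that by (simp add: p_def J_def)
  have p0: "p n \<ge> 0" for n
  proof (cases "n = 0")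
    case False
    \<comment> \<open>For n > 0 nonnegativity is read off from \<open>p n\<close> being a
      probability, with i = n as an index in \<open>{1..n}\<close>.\<close>
    then show ?thesis using tail[of n n] by (metis One_nat_def Suc_leI atLeastAtMost_iff measure_nonneg neq0_conv order_refl)
  qed (simp add: p_def)
  have "J \<longlonglongrightarrow> (LBINT u:{x<..}. exp (- u) / u)"
    unfolding J_def by (rule powr_tail_integral_tendsto[OF \<alpha>0 x])
  \<comment> \<open>Gamma is continuous at 1 with Gamma 1 = 1, so the denominator disappears in the
    limit.\<close>
  then have "(\<lambda>n. real n * \<alpha> n / Gamma (\<alpha> n + 1) * J n)
      \<longlonglongrightarrow> a / Gamma (0 + 1) * (LBINT u:{x<..}. exp (- u) / u)"
    by (intro tendsto_intros lim \<alpha>0) auto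
  moreover have "real n * \<alpha> n / Gamma (\<alpha> n + 1) * J n = real n * p n" for n
    by (simp add: p_def)
  ultimately have "(\<lambda>n. real n * p n) \<longlonglongrightarrow> a * (LBINT u:{x<..}. exp (- u) / u)" by simp
  then have "(\<lambda>n. (1 - p n) ^ n) \<longlonglongrightarrow> F_lim a x"
    unfolding F_lim_def using one_minus_power_tendsto_exp[OF p0] by simp
  \<comment> \<open>The identity is claimed only eventually, since \<open>row_max\<close> is
    unspecified at n = 0.\<close>
  moreover have "\<forall>\<^sub>F n in sequentially. (1 - p n) ^ n
      = measure (P n) {\<omega> \<in> space (P n). row_max Y n \<omega> \<le> x}"
    using eventually_ge_at_top[of 1]
    by eventually_elim (rule prob_space.row_max_cdf[OF prob _ indep tail, symmetric])
  ultimately show "(\<lambda>n. measure (P n) {\<omega> \<in> space (P n). row_max Y n \<omega> \<le> x}) \<longlonglongrightarrow> F_lim a x"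
    by (rule Lim_transform_eventually)
qed

end
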